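(* Let $\mathcal G = (\mathcal X\times \mathcal Y\times \mathcal Z,\ \mathcal A\times \mathcal B\times \mathcal C,\ Q,\ V)$ be a 3-player game with $\mathcal X = \mathcal Y = \mathcal Z = \mathcal A = \mathcal B= \mathcal C= \{0,1\}$, with $Q$ the uniform distribution over $\{(1,0,0),(0,1,0),(0,0,1)\}$, and such that $\mathrm{val}(\mathcal G)<1$. Then there exists a constant $c=c(\mathcal G)>0$ such that for every $n\in\mathbb N$, $\mathrm{val}(\mathcal G^{\otimes n})\le 2^{-cn}$.
   Context: For a $k$-player game with finite question set $\mathcal X=\prod_j\mathcal X^j$, answer set $\mathcal A=\prod_j\mathcal A^j$, distribution $Q$ on $\mathcal X$ and predicate $V:\mathcal X\times\mathcal A\to\{0,1\}$, the value $\mathrm{val}$ is the maximum over deterministic strategies $f^j:\mathcal X^j\to\mathcal A^j$ of $\Pr_{x\sim Q}[V(x,(f^j(x^j))_j)=1]$. The $n$-fold parallel repetition $\mathcal G^{\otimes n}$ draws $n$ i.i.d. question tuples from $Q$; player $j$ receives its $n$ questions and outputs $n$ answers, and the players win iff $V$ holds in every coordinate. *)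

theory Defs
  imports "HOL-Probability.Probability" "HOL-Probability.Product_PMF"
begin

text \<open>
  The players of a \<open>k\<close>-player game are the indices \<open>j < k\<close>. Question and answer tuples are
  elements of dependent products over \<^term>\<open>{..<k}\<close>, hence \<^term>\<open>undefined\<close> at
  indices \<open>j \<ge> k\<close>. The fields \<open>questions\<close>, \<open>answers\<close> and \<open>wins\<close> are only
  ever used on indices \<open>j < k\<close> and on such tuples.
\<close>

record ('q, 'a) game =
  players :: nat
  questions :: "nat \<Rightarrow> 'q set"
  answers :: "nat \<Rightarrow> 'a set"
  qdist :: "(nat \<Rightarrow> 'q) pmf"
  wins :: "(nat \<Rightarrow> 'q) \<Rightarrow> (nat \<Rightarrow> 'a) \<Rightarrow> bool"

definition valid_game :: "('q, 'a) game \<Rightarrow> bool" where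
  "valid_game G \<longleftrightarrow>
     (\<forall>j < players G. finite (questions G j)) \<and>
     (\<forall>j < players G. finite (answers G j) \<and> answers G j \<noteq> {}) \<and>
     set_pmf (qdist G) \<subseteq> Pi\<^sub>E {..<players G} (questions G)"

definition strategies :: "('q, 'a) game \<Rightarrow> (nat \<Rightarrow> 'q \<Rightarrow> 'a) set" where
  "strategies G = (\<Pi>\<^sub>E j\<in>{..<players G}. questions G j \<rightarrow>\<^sub>E answers G j)"

definition win_prob :: "('q, 'a) game \<Rightarrow> (nat \<Rightarrow> 'q \<Rightarrow> 'a) \<Rightarrow> real" where
  "win_prob G f =
     measure_pmf.prob (qdist G) {x. wins G x (\<lambda>j\<in>{..<players G}. f j (x j))}"

definition game_val :: "('q, 'a) game \<Rightarrow> real" where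
  "game_val G = Max (win_prob G ` strategies G)"

text \<open>
  In the repeated game, player \<open>j\<close> receives the vector of her \<open>n\<close> questions, so a sample
  \<open>q\<close> of \<open>n\<close> independent question tuples, with \<open>q i j\<close> the question to player \<open>j\<close> in
  coordinate \<open>i\<close>, has to be transposed.
\<close>

definition rep_game :: "nat \<Rightarrow> ('q, 'a) game \<Rightarrow> (nat \<Rightarrow> 'q, nat \<Rightarrow> 'a) game" where
  "rep_game n G =
     \<lparr> players = players G,
       questions = (\<lambda>j. {..<n} \<rightarrow>\<^sub>E questions G j),
       answers = (\<lambda>j. {..<n} \<rightarrow>\<^sub>E answers G j),
       qdist = map_pmf (\<lambda>q. \<lambda>j\<in>{..<players G}. \<lambda>i\<in>{..<n}. q i j)
                 (Pi_pmf {..<n} undefined (\<lambda>_. qdist G)),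
       wins = (\<lambda>x a. \<forall>i<n. wins G (\<lambda>j\<in>{..<players G}. x j i)
                                    (\<lambda>j\<in>{..<players G}. a j i)) \<rparr>"

definition triple :: "'q \<Rightarrow> 'q \<Rightarrow> 'q \<Rightarrow> nat \<Rightarrow> 'q" where
  "triple x y z = (\<lambda>j\<in>{..<3}. [x, y, z] ! j)"

lemma finite_strategies: "valid_game G \<Longrightarrow> finite (strategies G)"
  unfolding strategies_def valid_game_def by (auto intro!: finite_PiE)

lemma strategies_nonempty: "valid_game G \<Longrightarrow> strategies G \<noteq> {}"
  unfolding strategies_def valid_game_def by (simp add: PiE_eq_empty_iff)

lemma valid_game_rep_game:
  assumes "valid_game G"
  shows "valid_game (rep_game n G)"
proof -
  have "q i j \<in> questions G j"
    if "q \<in> set_pmf (Pi_pmf {..<n} undefined (\<lambda>_. qdist G))" "i < n" "j < players G" for q i j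
  proof -
    have "q i \<in> set_pmf (qdist G)"
      using that by (auto simp: set_Pi_pmf PiE_dflt_def)
    then show ?thesis
      using assms that(3) unfolding valid_game_def by (blast dest: PiE_mem)
  qed
  then show ?thesis
    using assms unfolding valid_game_def rep_game_def
    by (auto simp: PiE_eq_empty_iff intro!: finite_PiE)
qed

end

theory Submission
  imports Defs
begin

text \<open>
  Call the three question tuples \<open>U 0, U 1, U 2\<close>, where player \<open>e\<close> receives 1 in \<open>U e\<close>. The
  player who receives 1 knows the whole question, so the game is a 2-CSP on three boolean variables
  (the answers to 0) with one constraint per pair, and it has value less than 1 iff this CSP is
  unsatisfiable.

  Let \<open>S\<close> be the set of questions won by a strategy in the repeated game, and \<open>\<delta>\<close> its probability.
  Copying a random tuple of points conditionally independently, given some of its coordinate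
  functions, squares the probability that all points lie in \<open>S\<close> in the worst case (Jensen).
  Iterating this gives a product distribution on \<open>m\<close>-tuples of points, all of which lie in \<open>S\<close> with
  probability at least \<open>\<delta> ^ m\<close>, and in which prescribed players see the same question vector at
  prescribed points, hence give the same answers there. If some single-coordinate pattern of
  positive probability \<open>\<epsilon>\<close> makes the resulting constraints contradictory, it cannot occur in any
  coordinate, so \<open>\<delta> ^ m \<le> (1 - \<epsilon>) ^ n\<close>.

  For boolean answers two patterns suffice. If some value of a variable is excluded by a single
  constraint, a chain of four points is contradictory. Otherwise all constraints are matchings of
  odd total parity, and three copies of a star of four points, glued at three leaves, contain a
  contradictory cycle of length 9.
\<close>

section \<open>Conditionally independent copies\<close>

definition double_pmf :: "('k \<Rightarrow> 'l) \<Rightarrow> 'k pmf \<Rightarrow> ('k \<times> 'k) pmf" where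
  "double_pmf \<phi> p =
     bind_pmf (map_pmf \<phi> p)
       (\<lambda>l. pair_pmf (cond_pmf p {k. \<phi> k = l}) (cond_pmf p {k. \<phi> k = l}))"

lemma set_pmf_double_pmf:
  "set_pmf (double_pmf \<phi> p) = {(k, k'). k \<in> set_pmf p \<and> k' \<in> set_pmf p \<and> \<phi> k = \<phi> k'}"
proof -
  have "set_pmf (cond_pmf p {k. \<phi> k = \<phi> x}) = set_pmf p \<inter> {k. \<phi> k = \<phi> x}" if "x \<in> set_pmf p" for x
    using that by (intro set_cond_pmf) auto
  then show ?thesis
    unfolding double_pmf_def by auto
qed

lemma bind_cond_pmf_fibres: "bind_pmf (map_pmf \<phi> p) (\<lambda>l. cond_pmf p {k. \<phi> k = l}) = p"
  by (rule bind_cond_pmf_cancel)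
     (auto simp: pmf_map vimage_def measure_pmf_single Collect_conv_if)

lemma measure_bind_pmf:
  "measure_pmf.prob (bind_pmf q R) E = measure_pmf.expectation q (\<lambda>l. measure_pmf.prob (R l) E)"
proof -
  have *: "measure_pmf.prob p E = pmf (map_pmf (\<lambda>x. x \<in> E) p) True" for p
    by (simp add: pmf_map vimage_def)
  show ?thesis
    by (simp add: * map_bind_pmf pmf_bind)
qed

lemma measure_pair_pmf_times:
  "measure_pmf.prob (pair_pmf p q) (A \<times> B) = measure_pmf.prob p A * measure_pmf.prob q B"
proof -
  have "measure_pmf.prob (pair_pmf p q) (A \<times> B)
      = measure_pmf.expectation p (\<lambda>x. measure_pmf.prob (map_pmf (Pair x) q) (A \<times> B))"
    by (simp add: pair_pmf_def measure_bind_pmf map_pmf_def)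
  also have "\<dots> = measure_pmf.expectation p (\<lambda>x. indicator A x * measure_pmf.prob q B)"
    by (intro Bochner_Integration.integral_cong) (auto simp: vimage_def indicator_def)
  finally show ?thesis
    by simp
qed

text \<open>Given \<open>l\<close>, both copies lie in \<open>E\<close> with probability
  \<open>prob (R l) E\<close> squared, and a variance is nonnegative.\<close>

lemma measure_bind_pair_pmf_ge:
  "measure_pmf.prob (bind_pmf q R) E ^ 2
     \<le> measure_pmf.prob (bind_pmf q (\<lambda>l. pair_pmf (R l) (R l))) (E \<times> E)"
proof -
  let ?f = "\<lambda>l. measure_pmf.prob (R l) E"
  have i1: "integrable (measure_pmf q) ?f"
    by (rule measure_pmf.integrable_const_bound[where B = 1]) auto
  have i2: "integrable (measure_pmf q) (\<lambda>l. ?f l ^ 2)"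
    by (rule measure_pmf.integrable_const_bound[where B = 1]) (auto simp: power_le_one)
  have "0 \<le> measure_pmf.variance q ?f"
    by (simp add: measure_pmf.variance_positive)
  also have "\<dots> = measure_pmf.expectation q (\<lambda>l. ?f l ^ 2) - measure_pmf.expectation q ?f ^ 2"
    using i1 i2 by (rule measure_pmf.variance_eq)
  finally show ?thesis
    by (simp add: measure_bind_pmf measure_pair_pmf_times power2_eq_square)
qed

lemma Pi_pmf_pair:
  assumes "finite I"
  shows "Pi_pmf I (d, e) (\<lambda>i. pair_pmf (p i) (q i)) =
           map_pmf (\<lambda>(f, g) i. (f i, g i)) (pair_pmf (Pi_pmf I d p) (Pi_pmf I e q))"
proof (rule pmf_eqI)
  fix h :: "'a \<Rightarrow> 'b \<times> 'c"
  let ?F = "\<lambda>(f, g) (i::'a). (f i :: 'b, g i :: 'c)"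
  have inj: "inj ?F"
    by (auto simp: inj_def fun_eq_iff)
  have h: "h = ?F (fst \<circ> h, snd \<circ> h)"
    by (auto simp: fun_eq_iff)
  have "pmf (map_pmf ?F (pair_pmf (Pi_pmf I d p) (Pi_pmf I e q))) h =
        pmf (Pi_pmf I d p) (fst \<circ> h) * pmf (Pi_pmf I e q) (snd \<circ> h)"
    by (subst h, subst pmf_map_inj'[OF inj]) (simp add: pmf_pair)
  also have "\<dots> = pmf (Pi_pmf I (d, e) (\<lambda>i. pair_pmf (p i) (q i))) h"
  proof (cases "\<forall>x. x \<notin> I \<longrightarrow> h x = (d, e)")
    case True
    then show ?thesis
      using assms by (auto simp: pmf_Pi pmf_pair prod.distrib[symmetric] intro!: prod.cong)
                     (metis pmf_pair prod.collapse)
  next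
    case False
    then obtain x where "x \<notin> I" "h x \<noteq> (d, e)" by auto
    then show ?thesis
      using assms by (auto simp: pmf_Pi prod_eq_iff)
  qed
  finally show "pmf (Pi_pmf I (d, e) (\<lambda>i. pair_pmf (p i) (q i))) h = 
      pmf (map_pmf ?F (pair_pmf (Pi_pmf I d p) (Pi_pmf I e q))) h" ..
qed

text \<open>All coordinates are conditioned at once: the product is a mixture over the vector of
  \<open>\<phi>\<close>-values, so \<open>E\<close> may be any event and nothing is lost with the
  size of \<open>I\<close>.\<close>

lemma measure_Pi_double_pmf_ge:
  assumes "finite I"
  shows "measure_pmf.prob (Pi_pmf I d (\<lambda>_. p)) E ^ 2 \<le>
         measure_pmf.prob (Pi_pmf I (d, d) (\<lambda>_. double_pmf \<phi> p)) {h. fst \<circ> h \<in> E \<and> snd \<circ> h \<in> E}"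
proof -
  let ?R = "\<lambda>l. cond_pmf p {k. \<phi> k = l}"
  let ?Q = "Pi_pmf I (\<phi> d) (\<lambda>_. map_pmf \<phi> p)"
  let ?S = "\<lambda>f. Pi_pmf I d (\<lambda>i. ?R (f i))"
  let ?F = "\<lambda>(f, g) i. (f i, g i)"
  have 1: "Pi_pmf I d (\<lambda>_. p) = bind_pmf ?Q ?S"
    by (subst Pi_pmf_bind[OF assms, symmetric]) (simp add: bind_cond_pmf_fibres)
  have "Pi_pmf I (d, d) (\<lambda>_. double_pmf \<phi> p)
      = bind_pmf ?Q (\<lambda>f. Pi_pmf I (d, d) (\<lambda>i. pair_pmf (?R (f i)) (?R (f i))))"
    unfolding double_pmf_def by (rule Pi_pmf_bind[OF assms])
  then have 2: "Pi_pmf I (d, d) (\<lambda>_. double_pmf \<phi> p)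
      = map_pmf ?F (bind_pmf ?Q (\<lambda>f. pair_pmf (?S f) (?S f)))"
    by (simp add: Pi_pmf_pair[OF assms] map_bind_pmf)
  show ?thesis
    unfolding 1 2
    by (rule order_trans[OF measure_bind_pair_pmf_ge])
       (auto simp: comp_def intro!: measure_pmf.finite_measure_mono)
qed

section \<open>Tuples of points inside an arbitrary event\<close>

text \<open>
  \<open>p\<close> is the one-coordinate distribution of a tuple of points, and \<open>T\<close> consists of the projections of
  the tuple to its points; \<open>z\<close> and \<open>d\<close> are the default values of \<^const>\<open>Pi_pmf\<close>.
\<close>

definition sidorenko :: "'q pmf \<Rightarrow> 'q \<Rightarrow> 'k pmf \<Rightarrow> 'k \<Rightarrow> ('k \<Rightarrow> 'q) set \<Rightarrow> nat \<Rightarrow> bool" where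
  "sidorenko \<mu> z p d T m \<longleftrightarrow>
     (\<forall>(I :: nat set) S. finite I \<longrightarrow>
        measure_pmf.prob (Pi_pmf I z (\<lambda>_. \<mu>)) S ^ m
          \<le> measure_pmf.prob (Pi_pmf I d (\<lambda>_. p)) {h. \<forall>\<pi>\<in>T. \<pi> \<circ> h \<in> S})"

lemma sidorenko_id: "sidorenko \<mu> z \<mu> z {\<lambda>x. x} 1"
  by (simp add: sidorenko_def comp_def)

lemma sidorenko_double:
  assumes "sidorenko \<mu> z p d T m"
  shows "sidorenko \<mu> z (double_pmf \<phi> p) (d, d)
           ((\<lambda>\<pi> k. \<pi> (fst k)) ` T \<union> (\<lambda>\<pi> k. \<pi> (snd k)) ` T) (2 * m)"
  unfolding sidorenko_def
proof (intro allI impI)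
  fix I :: "nat set" and S :: "(nat \<Rightarrow> 'a) set"
  assume I: "finite I"
  let ?E = "{h. \<forall>\<pi>\<in>T. \<pi> \<circ> h \<in> S}"
  have "measure_pmf.prob (Pi_pmf I z (\<lambda>_. \<mu>)) S ^ (2 * m)
      = (measure_pmf.prob (Pi_pmf I z (\<lambda>_. \<mu>)) S ^ m) ^ 2"
    by (simp add: power_mult[symmetric] mult.commute)
  also have "\<dots> \<le> measure_pmf.prob (Pi_pmf I d (\<lambda>_. p)) ?E ^ 2"
    using assms I unfolding sidorenko_def by (intro power_mono) auto
  also have "\<dots> \<le> measure_pmf.prob (Pi_pmf I (d, d) (\<lambda>_. double_pmf \<phi> p))
                      {h. fst \<circ> h \<in> ?E \<and> snd \<circ> h \<in> ?E}"
    by (rule measure_Pi_double_pmf_ge[OF I])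
  also have "{h. fst \<circ> h \<in> ?E \<and> snd \<circ> h \<in> ?E} =
     {h. \<forall>\<pi>\<in>(\<lambda>\<pi> k. \<pi> (fst k)) ` T \<union> (\<lambda>\<pi> k. \<pi> (snd k)) ` T. \<pi> \<circ> h \<in> S}"
    by (auto simp: comp_def)
  finally show "measure_pmf.prob (Pi_pmf I z (\<lambda>_. \<mu>)) S ^ (2 * m)
     \<le> measure_pmf.prob (Pi_pmf I (d, d) (\<lambda>_. double_pmf \<phi> p))
         {h. \<forall>\<pi>\<in>(\<lambda>\<pi> k. \<pi> (fst k)) ` T \<union> (\<lambda>\<pi> k. \<pi> (snd k)) ` T. \<pi> \<circ> h \<in> S}" .
qed

text \<open>The event excludes \<open>k\<close> at every coordinate, and the coordinates are
  independent.\<close>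

lemma sidorenko_avoiding_bound:
  fixes I :: "nat set"
  assumes sid: "sidorenko \<mu> z p d T m" and I: "finite I"
    and avoid: "\<And>h i. i \<in> I \<Longrightarrow> h i = k \<Longrightarrow> (\<forall>i\<in>I. h i \<in> set_pmf p) \<Longrightarrow> (\<forall>\<pi>\<in>T. \<pi> \<circ> h \<in> S) \<Longrightarrow> False"
  shows "measure_pmf.prob (Pi_pmf I z (\<lambda>_. \<mu>)) S ^ m \<le> (1 - pmf p k) ^ card I"
proof -
  let ?P = "Pi_pmf I d (\<lambda>_. p)"
  let ?E = "{h. \<forall>\<pi>\<in>T. \<pi> \<circ> h \<in> S}"
  have "measure_pmf.prob (Pi_pmf I z (\<lambda>_. \<mu>)) S ^ m \<le> measure_pmf.prob ?P ?E"
    using sid I unfolding sidorenko_def by auto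
  \<comment> \<open>Inside the support, the relations of \<open>set_pmf p\<close> hold at all
    coordinates, as equality of whole question vectors requires.\<close>
  also have "\<dots> = measure_pmf.prob ?P (?E \<inter> set_pmf ?P)"
    by (simp add: measure_Int_set_pmf)
  also have "\<dots> \<le> measure_pmf.prob ?P (Pi I (\<lambda>_. - {k}))"
    using avoid I
    by (intro measure_pmf.finite_measure_mono) (auto simp: set_Pi_pmf PiE_dflt_def)
  also have "\<dots> = (\<Prod>i\<in>I. measure_pmf.prob p (- {k}))"
    using I by (rule measure_Pi_pmf_Pi)
  also have "\<dots> = (1 - pmf p k) ^ card I"
    using measure_pmf.prob_compl[of "{k}" p] by (simp add: measure_pmf_single Compl_eq_Diff_UNIV)
  finally show ?thesis .
qed

section \<open>Question vectors and triangle constraints\<close>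

definition unit_query :: "nat \<Rightarrow> nat \<Rightarrow> nat" where
  "unit_query e = (\<lambda>j\<in>{..<3}. if j = e then 1 else 0)"

lemma unit_query_eq [simp]: "j < 3 \<Longrightarrow> unit_query e j = (if j = e then 1 else 0)"
  by (simp add: unit_query_def)

definition query_pmf :: "(nat \<Rightarrow> nat) pmf" where
  "query_pmf = pmf_of_set (unit_query ` {..<3})"

lemma set_query_pmf: "set_pmf query_pmf = unit_query ` {..<3}"
  unfolding query_pmf_def by (rule set_pmf_of_set) (auto simp: lessThan_empty_iff)

text \<open>Extensional as in \<open>rep_game\<close>: agreement below \<open>n\<close> makes two
  vectors equal.\<close>

definition question_vector :: "nat \<Rightarrow> nat \<Rightarrow> (nat \<Rightarrow> nat \<Rightarrow> nat) \<Rightarrow> nat \<Rightarrow> nat" where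
  "question_vector n j q = (\<lambda>i\<in>{..<n}. q i j)"

lemma question_vector_cong: "(\<And>i. i < n \<Longrightarrow> q i j = q' i j) \<Longrightarrow> question_vector n j q = question_vector n j q'"
  by (auto simp: question_vector_def)

text \<open>\<open>P c d\<close> is the constraint tested when the third player \<open>e\<close>
  receives 1; \<open>{c, d, e} = {..<3}\<close> says that \<open>c\<close>, \<open>d\<close>,
  \<open>e\<close> permute the players.\<close>

locale triangle =
  fixes P :: "nat \<Rightarrow> nat \<Rightarrow> bool \<Rightarrow> bool \<Rightarrow> bool"
  assumes P_sym: "{c, d, e} = {..<3} \<Longrightarrow> P c d x y \<longleftrightarrow> P d c y x"
    and P_unsat: "{c, d, e} = {..<3} \<Longrightarrow> P c d x y \<Longrightarrow> P d e y w \<Longrightarrow> P c e x w \<Longrightarrow> False"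
begin

definition wins_on :: "nat \<Rightarrow> (nat \<Rightarrow> (nat \<Rightarrow> nat) \<Rightarrow> nat \<Rightarrow> bool) \<Rightarrow> (nat \<Rightarrow> nat \<Rightarrow> nat) set \<Rightarrow> bool" where
  "wins_on n F S \<longleftrightarrow>
     (\<forall>q\<in>S. \<forall>i<n. \<forall>c d e. {c, d, e} = {..<3} \<longrightarrow> q i = unit_query e \<longrightarrow>
        P c d (F c (question_vector n c q) i) (F d (question_vector n d q) i))"

lemma wins_onD:
  "wins_on n F S \<Longrightarrow> q \<in> S \<Longrightarrow> i < n \<Longrightarrow> q i = unit_query e \<Longrightarrow> {c, d, e} = {..<3} \<Longrightarrow>
     P c d (F c (question_vector n c q) i) (F d (question_vector n d q) i)"
  unfolding wins_on_def by blast

lemma exponential_bound_of_sidorenko: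
  assumes sid: "sidorenko query_pmf z p d T m" and m: "m > 0" and k: "k \<in> set_pmf p"
    and contra: "\<And>n F S h i. wins_on n F S \<Longrightarrow> i < n \<Longrightarrow> h i = k \<Longrightarrow> (\<And>i. i < n \<Longrightarrow> h i \<in> set_pmf p) \<Longrightarrow>
                  (\<forall>\<pi>\<in>T. (\<lambda>i. \<pi> (h i)) \<in> S) \<Longrightarrow> False"
  shows "\<exists>\<rho> m. 0 < \<rho> \<and> \<rho> < 1 \<and> 0 < m \<and> (\<forall>n F S. wins_on n F S \<longrightarrow>
           measure_pmf.prob (Pi_pmf {..<n} z (\<lambda>_. query_pmf)) S ^ m \<le> \<rho> ^ n)"
proof (intro exI conjI allI impI)
  \<comment> \<open>Halving keeps \<open>?\<rho>\<close> positive even if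
    \<open>pmf p k = 1\<close>; its logarithm is taken later.\<close>
  let ?\<rho> = "1 - pmf p k / 2"
  have pos: "0 < pmf p k"
    using k by (simp add: pmf_positive)
  show "0 < ?\<rho>" "?\<rho> < 1"
    using pos pmf_le_1[of p k] by auto
  show "0 < m" by (rule m)
  fix n F S
  assume F: "wins_on n F S"
  have "measure_pmf.prob (Pi_pmf {..<n} z (\<lambda>_. query_pmf)) S ^ m \<le> (1 - pmf p k) ^ card {..<n}"
  proof (rule sidorenko_avoiding_bound[OF sid])
    fix h :: "nat \<Rightarrow> 'a" and i
    assume "i \<in> {..<n}" "h i = k" "\<forall>i\<in>{..<n}. h i \<in> set_pmf p" "\<forall>\<pi>\<in>T. \<pi> \<circ> h \<in> S"
    then show False
      by (intro contra[OF F, of i h]) (auto simp: comp_def)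
  qed simp
  also have "\<dots> \<le> ?\<rho> ^ n"
    using pos pmf_le_1[of p k] by (simp add: power_mono)
  finally show "measure_pmf.prob (Pi_pmf {..<n} z (\<lambda>_. query_pmf)) S ^ m \<le> ?\<rho> ^ n" .
qed

section \<open>Contradictory patterns: the chain and the glued stars\<close>

text \<open>Excluding \<open>x\<close> fixes the answer of \<open>c\<close> wherever
  \<open>unit_query e\<close> is won. This equates answers of \<open>c\<close> at points sharing no
  vector and closes the chain into a triangle.\<close>

lemma bound_of_empty_row:
  assumes cde: "{c, d, e} = {..<3}" and row: "\<And>y. \<not> P c d x y"
  shows "\<exists>\<rho> m. 0 < \<rho> \<and> \<rho> < 1 \<and> 0 < m \<and> (\<forall>n F S. wins_on n F S \<longrightarrow>
           measure_pmf.prob (Pi_pmf {..<n} z (\<lambda>_. query_pmf)) S ^ m \<le> \<rho> ^ n)"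
proof -
  have card: "card {c, d, e} = 3"
    by (simp add: cde)
  have lt: "c < 3" "d < 3" "e < 3"
    using cde by auto
  have ne: "c \<noteq> d" "c \<noteq> e" "d \<noteq> e"
    using card by (auto simp: card_insert_if split: if_splits)
  note dist = lt ne ne[symmetric]
  have perm: "{c, e, d} = {..<3}" "{d, c, e} = {..<3}" "{e, d, c} = {..<3}" "{d, e, c} = {..<3}"
    using cde by auto
  let ?U = unit_query
  define p1 where "p1 = double_pmf (\<lambda>q. q c) query_pmf"
  define p2 where "p2 = double_pmf (\<lambda>k. fst k e) p1"
  define p3 where "p3 = double_pmf (\<lambda>k. fst (snd k) d) p2"
  note sid1 = sidorenko_double[OF sidorenko_id[of query_pmf z], where \<phi> = "\<lambda>q. q c", folded p1_def]
  note sid2 = sidorenko_double[OF sid1, where \<phi> = "\<lambda>k. fst k e", folded p2_def]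
  note sid = sidorenko_double[OF sid2, where \<phi> = "\<lambda>k. fst (snd k) d", folded p3_def]
  \<comment> \<open>The chain is \<open>q1, p1, p2, q2\<close>, with questions \<open>U e, U d, U c, U e\<close>; consecutive points share the
    vectors of \<open>c\<close>, \<open>e\<close> and \<open>d\<close>. Both occurrences of \<open>U e\<close> force \<open>c\<close> to answer \<open>\<not> x\<close>. The other
    entries of \<open>?k\<close> only fill the tuple consistently.\<close>
  let ?k = "(((?U d, ?U e), (?U c, ?U c)), ((?U e, ?U e), (?U e, ?U e)))"
  have k: "?k \<in> set_pmf p3"
    unfolding p3_def p2_def p1_def set_pmf_double_pmf set_query_pmf using dist by simp
  show ?thesis
  proof (rule exponential_bound_of_sidorenko[OF sid _ k], goal_cases)
    case (2 n F S h i)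
    note win = 2(1) and i = 2(2) and hi = 2(3)
    have supp: "h i \<in> set_pmf p3" if "i < n" for i
      using 2(4) that by auto
    let ?p1 = "\<lambda>i. fst (fst (fst (h i)))" and ?q1 = "\<lambda>i. snd (fst (fst (h i)))"
    let ?p2 = "\<lambda>i. fst (snd (fst (h i)))" and ?q2 = "\<lambda>i. fst (snd (snd (h i)))"
    have S: "?p1 \<in> S" "?q1 \<in> S" "?p2 \<in> S" "?q2 \<in> S"
      using 2(5) by auto
    have eq: "question_vector n c ?q1 = question_vector n c ?p1" "question_vector n e ?p2 = question_vector n e ?p1"
      "question_vector n d ?q2 = question_vector n d ?p2"
      using supp by (auto intro!: question_vector_cong simp: p3_def p2_def p1_def set_pmf_double_pmf case_prod_beta)
    note W = wins_onD[OF win _ i]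
    have "P c d (F c (question_vector n c ?p1) i) (F d (question_vector n d ?q1) i)"
      using W[OF S(2) _ cde] hi eq by simp
    moreover have "P c e (F c (question_vector n c ?p1) i) (F e (question_vector n e ?p1) i)"
      using W[OF S(1) _ perm(1)] hi by simp
    moreover have "P d e (F d (question_vector n d ?p2) i) (F e (question_vector n e ?p1) i)"
      using W[OF S(3) _ perm(4)] hi eq by simp
    moreover have "P c d (F c (question_vector n c ?q2) i) (F d (question_vector n d ?p2) i)"
      using W[OF S(4) _ cde] hi eq by simp
    ultimately show False
      using row P_unsat[OF cde, of "F c (question_vector n c ?p1) i" "F d (question_vector n d ?p2) i"
          "F e (question_vector n e ?p1) i"]
      by (cases x; cases "F c (question_vector n c ?q2) i"; cases "F c (question_vector n c ?p1) i") auto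
  qed simp
qed

text \<open>
  If every row of every constraint is nonempty, then unsatisfiability forces each constraint to be
  a perfect matching of the two answers, so the game is an odd cycle of XOR constraints.
\<close>

lemma xor_of_full_rows:
  assumes full: "\<And>c d e x. {c, d, e} = {..<3} \<Longrightarrow> \<exists>y. P c d x y"
  shows "\<exists>s. (\<forall>c d e x y. {c, d, e} = {..<3} \<longrightarrow> P c d x y \<longleftrightarrow> y = (x \<noteq> s c d)) \<and>
           s 0 1 = (s 1 2 = s 0 2)"
proof -
  \<comment> \<open>If \<open>x\<close> allowed both answers of \<open>d\<close>, any walk from
    \<open>x\<close> over \<open>e\<close> to \<open>d\<close> would close up to a solution.\<close>
  have unique: "y = y'" if cde: "{c, d, e} = {..<3}" and y: "P c d x y" "P c d x y'" for c d e x y y'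
  proof (rule ccontr)
    assume "y \<noteq> y'"
    have perm: "{c, e, d} = {..<3}" "{e, d, c} = {..<3}" "{d, e, c} = {..<3}"
      using cde by auto
    obtain w where w: "P c e x w"
      using full[OF perm(1)] by blast
    obtain v where v: "P e d w v"
      using full[OF perm(2)] by blast
    have "P c d x v"
      using y \<open>y \<noteq> y'\<close> by (cases v; cases y; cases y') auto
    moreover have "P d e v w"
      using v P_sym[OF perm(2)] by simp
    ultimately show False
      using P_unsat[OF cde] w by blast
  qed
  have eq: "P c d x y \<longleftrightarrow> y = (x \<noteq> P c d False True)" if cde: "{c, d, e} = {..<3}" for c d e x y
  proof -
    have dce: "{d, c, e} = {..<3}"
      using cde by auto
    have row: "P c d u True \<longleftrightarrow> \<not> P c d u False" for u
    proof -
      obtain y where "P c d u y" using full[OF cde] by blast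
      then show ?thesis
        using unique[OF cde, of u True False] by (cases y) auto
    qed
    have col: "P c d True v \<longleftrightarrow> \<not> P c d False v" for v
    proof -
      obtain x where "P d c v x" using full[OF dce] by blast
      then show ?thesis
        using unique[OF dce, of v True False] P_sym[OF dce] by (cases x) auto
    qed
    show ?thesis
      using row[of False] row[of True] col[of True] by (cases x; cases y) auto
  qed
  have t: "{0, 1, 2} = {..<3::nat}" "{1, 2, 0} = {..<3::nat}" "{0, 2, 1} = {..<3::nat}"
    by auto
  show ?thesis
  proof (intro exI[of _ "\<lambda>c d. P c d False True"] conjI allI impI)
    show "P c d x y \<longleftrightarrow> y = (x \<noteq> P c d False True)" if "{c, d, e} = {..<3}" for c d e x y
      using that by (rule eq)
    \<comment> \<open>Setting variable 0 to \<open>False\<close> determines the other two; the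
      failure of the last constraint is the odd parity.\<close>
    define s01 s12 s02 where defs: "s01 = P 0 1 False True" "s12 = P 1 2 False True" "s02 = P 0 2 False True"
    have "P 0 1 False s01"
      by (subst eq[OF t(1)]) (simp add: defs)
    moreover have "P 0 2 False s02"
      by (subst eq[OF t(3)]) (simp add: defs)
    ultimately have "\<not> P 1 2 s01 s02"
      using P_unsat[OF t(1)] by blast
    then have "s01 = (s12 = s02)"
      unfolding eq[OF t(2), of s01 s02, folded defs] by auto
    then show "P 0 1 False True = (P 1 2 False True = P 0 2 False True)"
      unfolding defs .
  qed
qed

text \<open>Consistent answers make the parities around a cycle sum to an even number, but using
  each constraint three times gives three times the odd total.\<close>

lemma bound_of_full_rows:
  assumes full: "\<And>c d e x. {c, d, e} = {..<3} \<Longrightarrow> \<exists>y. P c d x y"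
  shows "\<exists>\<rho> m. 0 < \<rho> \<and> \<rho> < 1 \<and> 0 < m \<and> (\<forall>n F S. wins_on n F S \<longrightarrow>
           measure_pmf.prob (Pi_pmf {..<n} z (\<lambda>_. query_pmf)) S ^ m \<le> \<rho> ^ n)"
proof -
  have "\<exists>s. (\<forall>c d e x y. {c, d, e} = {..<3} \<longrightarrow> P c d x y \<longleftrightarrow> y = (x \<noteq> s c d)) \<and>
           s 0 1 = (s 1 2 = s 0 2)"
    by (rule xor_of_full_rows) (rule full)
  then obtain s where s: "\<forall>c d e x y. {c, d, e} = {..<3} \<longrightarrow> P c d x y \<longleftrightarrow> y = (x \<noteq> s c d)"
    and odd: "s 0 1 = (s 1 2 = s 0 2)"
    by (elim exE conjE)
  have t: "{0, 1, 2} = {..<3::nat}" "{1, 2, 0} = {..<3::nat}" "{0, 2, 1} = {..<3::nat}"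
    by auto
  let ?U = unit_query
  define \<phi> where "\<phi> = (\<lambda>k :: (((nat \<Rightarrow> nat) \<times> (nat \<Rightarrow> nat)) \<times> ((nat \<Rightarrow> nat) \<times> (nat \<Rightarrow> nat)))
        \<times> (((nat \<Rightarrow> nat) \<times> (nat \<Rightarrow> nat)) \<times> ((nat \<Rightarrow> nat) \<times> (nat \<Rightarrow> nat))).
      (snd (fst (fst k)) 1, fst (snd (fst k)) 2, fst (fst (snd k)) 0))"
  define p1 where "p1 = double_pmf (\<lambda>q. q 0) query_pmf"
  define p2 where "p2 = double_pmf (\<lambda>k. fst k 1) p1"
  define p3 where "p3 = double_pmf (\<lambda>k. fst (fst k) 2) p2"
  define p4 where "p4 = double_pmf \<phi> p3"
  \<comment> \<open>All four stars now agree in \<open>\<phi>\<close>; three form the cycle, and the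
    fourth repeats \<open>?C\<close>.\<close>
  define p5 where "p5 = double_pmf (\<lambda>k. \<phi> (fst k)) p4"
  note sid1 = sidorenko_double[OF sidorenko_id[of query_pmf z], where \<phi> = "\<lambda>q. q 0", folded p1_def]
  note sid2 = sidorenko_double[OF sid1, where \<phi> = "\<lambda>k. fst k 1", folded p2_def]
  note sid3 = sidorenko_double[OF sid2, where \<phi> = "\<lambda>k. fst (fst k) 2", folded p3_def]
  note sid4 = sidorenko_double[OF sid3, where \<phi> = \<phi>, folded p4_def]
  note sid = sidorenko_double[OF sid4, where \<phi> = "\<lambda>k. \<phi> (fst k)", folded p5_def]
  \<comment> \<open>In each copy the centre \<open>p\<close> of the star shares a vector with \<open>q1\<close>, \<open>q2\<close>, \<open>q3\<close>, and \<open>\<phi>\<close> fixes one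
    further vector \<open>v\<close>, \<open>w\<close>, \<open>t\<close> of \<open>q1\<close>, \<open>q2\<close>, \<open>q3\<close>. Patterns \<open>?A\<close>, \<open>?B\<close>, \<open>?C\<close> connect \<open>v\<close> to \<open>w\<close>, \<open>w\<close> to \<open>t\<close>
    and \<open>t\<close> to \<open>v\<close> by paths of length 3 through \<open>p\<close>, using each pair of players three times in total.\<close>
  let ?A = "(((?U 2, ?U 2), (?U 0, ?U 0)), ((?U 2, ?U 2), (?U 2, ?U 2)))"
  let ?B = "(((?U 0, ?U 0), (?U 0, ?U 0)), ((?U 1, ?U 1), (?U 1, ?U 1)))"
  let ?C = "(((?U 1, ?U 2), (?U 1, ?U 1)), ((?U 1, ?U 1), (?U 1, ?U 1)))"
  let ?k = "((?A, ?B), (?C, ?C))"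
  have "?A \<in> set_pmf p3" "?B \<in> set_pmf p3" "?C \<in> set_pmf p3"
    unfolding p3_def p2_def p1_def set_pmf_double_pmf set_query_pmf by simp_all
  \<comment> \<open>\<open>\<phi>\<close> is \<open>(0, 0, 0)\<close> on all three patterns, so they
    can be glued.\<close>
  then have k: "?k \<in> set_pmf p5"
    unfolding p5_def p4_def set_pmf_double_pmf by (simp add: \<phi>_def)
  show ?thesis
  proof (rule exponential_bound_of_sidorenko[OF sid _ k], goal_cases)
    case (2 n F S h i)
    note win = 2(1) and i = 2(2) and hi = 2(3)
    have supp: "h i \<in> set_pmf p5" if "i < n" for i
      using 2(4) that by auto
    define a where "a = (\<lambda>i. fst (fst (h i)))"
    define b where "b = (\<lambda>i. snd (fst (h i)))"
    define c where "c = (\<lambda>i. fst (snd (h i)))"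
    have abc: "a i \<in> set_pmf p3" "b i \<in> set_pmf p3" "c i \<in> set_pmf p3"
      "\<phi> (a i) = \<phi> (b i)" "\<phi> (a i) = \<phi> (c i)" if "i < n" for i
      using supp[OF that]
      by (auto simp: a_def b_def c_def p5_def p4_def set_pmf_double_pmf case_prod_beta)
    let ?p = "\<lambda>k i. fst (fst (fst (k i)))" and ?q1 = "\<lambda>k i. snd (fst (fst (k i)))"
    let ?q2 = "\<lambda>k i. fst (snd (fst (k i)))" and ?q3 = "\<lambda>k i. fst (fst (snd (k i)))"
    have S: "?p k \<in> S" "?q1 k \<in> S" "?q2 k \<in> S" "?q3 k \<in> S" if "k \<in> {a, b, c}" for k
      using 2(5) that by (auto simp: a_def b_def c_def)
    have eq: "question_vector n 0 (?q1 k) = question_vector n 0 (?p k)" "question_vector n 1 (?q2 k) = question_vector n 1 (?p k)"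
      "question_vector n 2 (?q3 k) = question_vector n 2 (?p k)" if "\<And>i. i < n \<Longrightarrow> k i \<in> set_pmf p3" for k
      using that by (auto intro!: question_vector_cong simp: p3_def p2_def p1_def set_pmf_double_pmf case_prod_beta)
    have eq': "question_vector n 1 (?q1 b) = question_vector n 1 (?q1 a)" "question_vector n 1 (?q1 c) = question_vector n 1 (?q1 a)"
      "question_vector n 2 (?q2 b) = question_vector n 2 (?q2 a)" "question_vector n 2 (?q2 c) = question_vector n 2 (?q2 a)"
      "question_vector n 0 (?q3 b) = question_vector n 0 (?q3 a)" "question_vector n 0 (?q3 c) = question_vector n 0 (?q3 a)"
      using abc(4,5) by (auto intro!: question_vector_cong simp: \<phi>_def)
    have val: "a i = ?A" "b i = ?B" "c i = ?C"
      using hi by (simp_all add: a_def b_def c_def)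
    have W: "F d (question_vector n d q) i = (F c (question_vector n c q) i \<noteq> s c d)"
      if "q \<in> S" "q i = ?U e" "{c, d, e} = {..<3}" for c d e q
      using wins_onD[OF win that(1) i that(2,3)] s that(3) by simp
    note W01 = W[OF _ _ t(1)] and W12 = W[OF _ _ t(2)] and W02 = W[OF _ _ t(3)]
    note E = eq[OF abc(1)] eq[OF abc(2)] eq[OF abc(3)] eq'
    have "F 1 (question_vector n 1 (?q1 a)) i = (F 0 (question_vector n 0 (?p a)) i \<noteq> s 0 1)"
      using W01[of "?q1 a"] S val E by simp
    moreover have "F 1 (question_vector n 1 (?p a)) i = (F 0 (question_vector n 0 (?p a)) i \<noteq> s 0 1)"
      using W01[of "?p a"] S val E by simp
    moreover have "F 2 (question_vector n 2 (?q2 a)) i = (F 1 (question_vector n 1 (?p a)) i \<noteq> s 1 2)"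
      using W12[of "?q2 a"] S val E by simp
    moreover have "F 2 (question_vector n 2 (?q2 a)) i = (F 1 (question_vector n 1 (?p b)) i \<noteq> s 1 2)"
      using W12[of "?q2 b"] S val E by simp
    moreover have "F 2 (question_vector n 2 (?p b)) i = (F 1 (question_vector n 1 (?p b)) i \<noteq> s 1 2)"
      using W12[of "?p b"] S val E by simp
    moreover have "F 2 (question_vector n 2 (?p b)) i = (F 0 (question_vector n 0 (?q3 a)) i \<noteq> s 0 2)"
      using W02[of "?q3 b"] S val E by simp
    moreover have "F 2 (question_vector n 2 (?p c)) i = (F 0 (question_vector n 0 (?q3 a)) i \<noteq> s 0 2)"
      using W02[of "?q3 c"] S val E by simp
    moreover have "F 2 (question_vector n 2 (?p c)) i = (F 0 (question_vector n 0 (?p c)) i \<noteq> s 0 2)"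
      using W02[of "?p c"] S val E by simp
    moreover have "F 1 (question_vector n 1 (?q1 a)) i = (F 0 (question_vector n 0 (?p c)) i \<noteq> s 0 1)"
      using W01[of "?q1 c"] S val E by simp
    ultimately show False
      using odd by argo
  qed simp
qed

lemma exponential_bound:
  "\<exists>\<rho> m. 0 < \<rho> \<and> \<rho> < 1 \<and> 0 < m \<and> (\<forall>n F S. wins_on n F S \<longrightarrow>
           measure_pmf.prob (Pi_pmf {..<n} z (\<lambda>_. query_pmf)) S ^ m \<le> \<rho> ^ n)"
proof (cases "\<exists>c d e x. {c, d, e} = {..<3} \<and> (\<forall>y. \<not> P c d x y)")
  case True
  then obtain c d e x where cde: "{c, d, e} = {..<3}" and row: "\<forall>y. \<not> P c d x y"
    by (elim exE conjE)
  show ?thesis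
    by (rule bound_of_empty_row[OF cde, of x]) (simp add: row)
next
  case False
  have "\<exists>y. P c d x y" if "{c, d, e} = {..<3}" for c d e x
    using False that by blast
  then show ?thesis
    by (rule bound_of_full_rows)
qed

end

section \<open>From the game to the constraints\<close>

text \<open>The indices sum to 3, so \<open>3 - c - d\<close> names the player who receives 1
  without a third argument.\<close>

lemma distinct_of_eq_lessThan_3:
  assumes "{c, d, e} = {..<3::nat}"
  shows "c < 3" "d < 3" "e < 3" "c \<noteq> d" "c \<noteq> e" "d \<noteq> e" "3 - c - d = e"
proof -
  show lt: "c < 3" "d < 3" "e < 3"
    using assms by auto
  have "card {c, d, e} = 3"
    by (simp add: assms)
  then show "c \<noteq> d" "c \<noteq> e" "d \<noteq> e"
    by (auto simp: card_insert_if split: if_splits)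
  with lt show "3 - c - d = e"
    by linarith
qed

lemma pmf_of_set_triple_eq_query_pmf:
  "pmf_of_set {triple 1 0 0, triple 0 1 0, triple 0 0 1} = query_pmf"
proof -
  have [simp]: "triple x y z = (\<lambda>j\<in>{..<3}. if j = 0 then x else if j = 1 then y else z)" for x y z :: nat
    by (auto simp: triple_def fun_eq_iff less_Suc_eq eval_nat_numeral)
  have "unit_query 0 = triple 1 0 0" "unit_query 1 = triple 0 1 0" "unit_query 2 = triple 0 0 1"
    by (auto simp: unit_query_def fun_eq_iff)
  moreover have "{..<3::nat} = {0, 1, 2}"
    by auto
  ultimately show ?thesis
    by (simp only: query_pmf_def image_insert image_empty)
qed

text \<open>
  The player who receives 1 knows the whole question, so her answer can be optimized away and only
  a constraint between the other two players, both of whom receive 0, remains.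
\<close>

definition answer_constraint :: "(nat, nat) game \<Rightarrow> nat \<Rightarrow> nat \<Rightarrow> bool \<Rightarrow> bool \<Rightarrow> bool" where
  "answer_constraint G c d x y \<longleftrightarrow>
     (\<exists>t\<in>{0, 1}. wins G (unit_query (3 - c - d))
        (\<lambda>j\<in>{..<3}. if j = c then of_bool x else if j = d then of_bool y else t))"

lemma answer_constraintD:
  assumes "answer_constraint G c d x y" "{c, d, e} = {..<3}"
  shows "\<exists>t\<in>{0, 1}. \<forall>a. a c = of_bool x \<longrightarrow> a d = of_bool y \<longrightarrow> a e = t \<longrightarrow>
           wins G (unit_query e) (restrict a {..<3})"
proof -
  note D = distinct_of_eq_lessThan_3[OF assms(2)]
  obtain t where t: "t \<in> {0, 1}" "wins G (unit_query e)
        (\<lambda>j\<in>{..<3}. if j = c then of_bool x else if j = d then of_bool y else t)"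
    using assms(1) unfolding answer_constraint_def D(7) by blast
  show ?thesis
  proof (intro bexI[OF _ t(1)] allI impI)
    fix a :: "nat \<Rightarrow> nat"
    assume "a c = of_bool x" "a d = of_bool y" "a e = t"
    then have "(\<lambda>j\<in>{..<3}. if j = c then of_bool x else if j = d then of_bool y else t) = restrict a {..<3}"
      using assms(2) by (auto simp: fun_eq_iff restrict_def)
    then show "wins G (unit_query e) (restrict a {..<3})"
      using t(2) by simp
  qed
qed

lemma answer_constraintI:
  assumes "wins G (unit_query e) (restrict a {..<3})" "{c, d, e} = {..<3}" "\<And>j. j < 3 \<Longrightarrow> a j \<in> {0, 1}"
  shows "answer_constraint G c d (a c = 1) (a d = 1)"
proof -
  note D = distinct_of_eq_lessThan_3[OF assms(2)]
  have "(\<lambda>j\<in>{..<3}. if j = c then of_bool (a c = 1) else if j = d then of_bool (a d = 1) else a e)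
      = restrict a {..<3}"
    using assms(2) assms(3)[OF D(1)] assms(3)[OF D(2)] by (auto simp: fun_eq_iff restrict_def)
  then show ?thesis
    unfolding answer_constraint_def D(7) using assms(1) assms(3)[OF D(3)]
    by (intro bexI[of _ "a e"]) auto
qed

text \<open>A satisfying assignment would give a perfect strategy: on 0 answer its value, on 1 the
  witness \<open>t\<close> of the constraint between the other two players.\<close>

lemma triangle_answer_constraint:
  fixes G :: "(nat, nat) game"
  assumes valid: "valid_game G"
    and players: "players G = 3"
    and questions: "\<And>j. j < 3 \<Longrightarrow> questions G j = {0, 1}"
    and answers: "\<And>j. j < 3 \<Longrightarrow> answers G j = {0, 1}"
    and qdist: "qdist G = query_pmf"
    and val: "game_val G < 1"
  shows "triangle (answer_constraint G)"
proof
  fix c d e x y w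
  assume cde: "{c, d, e} = {..<3::nat}"
  note D = distinct_of_eq_lessThan_3[OF cde]
  have perm: "{d, c, e} = {..<3}" "{d, e, c} = {..<3}" "{c, e, d} = {..<3}"
    using cde by auto
  show "answer_constraint G c d x y = answer_constraint G d c y x"
    using D(4,5,6) distinct_of_eq_lessThan_3(7)[OF perm(1)] D(7)
    unfolding answer_constraint_def
    by (intro bex_cong refl arg_cong2[of _ _ _ _ "wins G"] restrict_ext) auto
  assume P: "answer_constraint G c d x y" "answer_constraint G d e y w" "answer_constraint G c e x w"
  obtain te where te: "te \<in> {0, 1}" "\<And>a. a c = of_bool x \<Longrightarrow> a d = of_bool y \<Longrightarrow> a e = te \<Longrightarrow>
      wins G (unit_query e) (restrict a {..<3})"
    using answer_constraintD[OF P(1) cde] by blast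
  obtain tc where tc: "tc \<in> {0, 1}" "\<And>a. a d = of_bool y \<Longrightarrow> a e = of_bool w \<Longrightarrow> a c = tc \<Longrightarrow>
      wins G (unit_query c) (restrict a {..<3})"
    using answer_constraintD[OF P(2) perm(2)] by blast
  obtain td where td: "td \<in> {0, 1}" "\<And>a. a c = of_bool x \<Longrightarrow> a e = of_bool w \<Longrightarrow> a d = td \<Longrightarrow>
      wins G (unit_query d) (restrict a {..<3})"
    using answer_constraintD[OF P(3) perm(3)] by blast
  define g :: "nat \<Rightarrow> nat \<Rightarrow> nat" where "g = (\<lambda>j q. if q = 0
      then (if j = c then of_bool x else if j = d then of_bool y else of_bool w)
      else (if j = c then tc else if j = d then td else te))"
  define f where "f = (\<lambda>j\<in>{..<3}. \<lambda>q\<in>{0, 1}. g j q)"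
  have f: "f \<in> strategies G"
    using te(1) tc(1) td(1)
    unfolding strategies_def f_def players
    by (auto simp: questions answers g_def split: if_splits)
  have "wins G q (\<lambda>j\<in>{..<players G}. f j (q j))" if q: "q \<in> set_pmf (qdist G)" for q
  proof -
    obtain k where k: "k < 3" "q = unit_query k"
      using q by (auto simp: qdist set_query_pmf)
    have eq: "(\<lambda>j\<in>{..<players G}. f j (q j)) = restrict (\<lambda>j. g j (unit_query k j)) {..<3}"
      by (auto simp: players f_def k fun_eq_iff restrict_def)
    have "k \<in> {c, d, e}"
      using k(1) cde by simp
    then consider "k = c" | "k = d" | "k = e"
      by blast
    then show ?thesis
    proof cases
      case 1
      show ?thesis
        unfolding eq unfolding k(2) 1 using D(1-6) by (intro tc(2)) (simp_all add: g_def)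
    next
      case 2
      show ?thesis
        unfolding eq unfolding k(2) 2 using D(1-6) by (intro td(2)) (simp_all add: g_def)
    next
      case 3
      show ?thesis
        unfolding eq unfolding k(2) 3 using D(1-6) by (intro te(2)) (simp_all add: g_def)
    qed
  qed
  then have "win_prob G f = 1"
    unfolding win_prob_def by (intro measure_pmf.prob_eq_1[THEN iffD2]) (auto simp: AE_measure_pmf_iff)
  then have "1 \<le> game_val G"
    unfolding game_val_def using f finite_strategies[OF valid] by (intro Max_ge) force+
  then show False
    using val by simp
qed

text \<open>\<open>S\<close> collects the won samples before transposition, and answer 1 is read as
  \<open>True\<close>. Forgetting the answer of the player who receives 1 only weakens
  winning.\<close>

lemma win_prob_rep_game_le:
  fixes G :: "(nat, nat) game"
  assumes valid: "valid_game G"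
    and players: "players G = 3"
    and questions: "\<And>j. j < 3 \<Longrightarrow> questions G j = {0, 1}"
    and answers: "\<And>j. j < 3 \<Longrightarrow> answers G j = {0, 1}"
    and qdist: "qdist G = query_pmf"
    and tri: "triangle (answer_constraint G)"
    and f: "f \<in> strategies (rep_game n G)"
  shows "\<exists>F S. triangle.wins_on (answer_constraint G) n F S \<and>
           win_prob (rep_game n G) f = measure_pmf.prob (Pi_pmf {..<n} undefined (\<lambda>_. query_pmf)) S"
proof -
  interpret triangle "answer_constraint G"
    by (rule tri)
  let ?P = "Pi_pmf {..<n} undefined (\<lambda>_. query_pmf)"
  let ?tr = "\<lambda>q. \<lambda>j\<in>{..<players G}. \<lambda>i\<in>{..<n}. q i j"
  let ?win = "\<lambda>x. wins (rep_game n G) x (\<lambda>j\<in>{..<3}. f j (x j))"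
  \<comment> \<open>The support has full probability and makes all questions, hence all answers, 0
    or 1.\<close>
  define S where "S = {q. ?win (?tr q)} \<inter> set_pmf ?P"
  have "win_prob (rep_game n G) f = measure_pmf.prob (map_pmf ?tr ?P) {x. ?win x}"
    by (simp add: win_prob_def rep_game_def players qdist)
  also have "\<dots> = measure_pmf.prob ?P S"
    by (simp add: S_def measure_Int_set_pmf vimage_def)
  finally have "win_prob (rep_game n G) f = measure_pmf.prob ?P S" .
  moreover have "wins_on n (\<lambda>j x i. f j x i = 1) S"
    unfolding wins_on_def
  proof (intro ballI allI impI)
    fix q i c d e
    assume q: "q \<in> S" and i: "i < n" and cde: "{c, d, e} = {..<3::nat}" and qi: "q i = unit_query e"
    have supp: "q i \<in> unit_query ` {..<3}" if "i < n" for i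
      using q that by (auto simp: S_def set_Pi_pmf PiE_dflt_def set_query_pmf)
    have col: "question_vector n j q \<in> {..<n} \<rightarrow>\<^sub>E {0, 1}" if "j < 3" for j
    proof -
      have "q i j \<in> {0, 1}" if "i < n" for i
        using supp[OF that] \<open>j < 3\<close> by auto
      then show ?thesis
        by (auto simp: question_vector_def)
    qed
    have ans: "f j (question_vector n j q) i \<in> {0, 1}" if "j < 3" for j
    proof -
      have "f \<in> (\<Pi>\<^sub>E j\<in>{..<3}. ({..<n} \<rightarrow>\<^sub>E questions G j) \<rightarrow>\<^sub>E ({..<n} \<rightarrow>\<^sub>E answers G j))"
        using f by (simp add: strategies_def rep_game_def players)
      from PiE_mem[OF this, of j] have "f j \<in> ({..<n} \<rightarrow>\<^sub>E {0, 1}) \<rightarrow>\<^sub>E ({..<n} \<rightarrow>\<^sub>E {0, 1})"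
        using that by (simp add: questions answers)
      then show ?thesis
        using col[OF that] i by (blast dest: PiE_mem)
    qed
    have "?win (?tr q)"
      using q by (simp add: S_def)
    then have "wins G (\<lambda>j\<in>{..<3}. q i j) (\<lambda>j\<in>{..<3}. f j (question_vector n j q) i)"
      using i by (auto simp: rep_game_def players question_vector_def cong: restrict_cong)
    also have "(\<lambda>j\<in>{..<3}. q i j) = unit_query e"
      by (auto simp: qi unit_query_def)
    finally show "answer_constraint G c d (f c (question_vector n c q) i = 1) (f d (question_vector n d q) i = 1)"
      using cde ans by (rule answer_constraintI)
  qed
  ultimately show ?thesis
    by blast
qed

theorem theorem7p1:
  fixes G :: "(nat, nat) game"
  assumes "valid_game G"
    and "players G = 3"
    and "\<And>j. j < 3 \<Longrightarrow> questions G j = {0, 1}"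
    and "\<And>j. j < 3 \<Longrightarrow> answers G j = {0, 1}"
    and "qdist G = pmf_of_set {triple 1 0 0, triple 0 1 0, triple 0 0 1}"
    and "game_val G < 1"
  shows "\<exists>c::real. c > 0 \<and> (\<forall>n::nat. game_val (rep_game n G) \<le> 2 powr (- c * real n))"
proof -
  have qdist: "qdist G = query_pmf"
    using assms(5) pmf_of_set_triple_eq_query_pmf by simp
  have tri: "triangle (answer_constraint G)"
    using assms(1-4) qdist assms(6) by (rule triangle_answer_constraint)
  obtain \<rho> :: real and m :: nat where \<rho>: "0 < \<rho>" "\<rho> < 1" and m: "0 < m"
    and bound: "\<And>n F S. triangle.wins_on (answer_constraint G) n F S \<Longrightarrow>
      measure_pmf.prob (Pi_pmf {..<n} undefined (\<lambda>_. query_pmf)) S ^ m \<le> \<rho> ^ n"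
    using triangle.exponential_bound[OF tri, of undefined] by blast
  \<comment> \<open>Chosen so that \<open>2 powr (- c * real n)\<close> is the \<open>m\<close>-th
    root of \<open>\<rho> ^ n\<close>.\<close>
  define c where "c = - log 2 \<rho> / real m"
  have "c > 0"
    using \<rho> m by (simp add: c_def divide_neg_pos)
  moreover have "game_val (rep_game n G) \<le> 2 powr (- c * real n)" for n
  proof -
    have pow: "(2 powr (- c * real n)) ^ m = \<rho> ^ n"
    proof -
      have "(2 powr (- c * real n)) ^ m = 2 powr (log 2 \<rho> * real n)"
        using m by (simp add: c_def powr_power)
      also have "\<dots> = \<rho> ^ n"
        using \<rho> by (simp add: powr_powr[symmetric] powr_realpow)
      finally show ?thesis .
    qed
    have "win_prob (rep_game n G) f \<le> 2 powr (- c * real n)" if f: "f \<in> strategies (rep_game n G)" for f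
    proof -
      obtain F S where "triangle.wins_on (answer_constraint G) n F S"
        and eq: "win_prob (rep_game n G) f = measure_pmf.prob (Pi_pmf {..<n} undefined (\<lambda>_. query_pmf)) S"
        using win_prob_rep_game_le[OF assms(1-4) qdist tri f] by blast
      then have "win_prob (rep_game n G) f ^ m \<le> (2 powr (- c * real n)) ^ m"
        using bound pow by simp
      then show ?thesis
        using m by (simp add: eq power_mono_iff)
    qed
    then show ?thesis
      unfolding game_val_def using valid_game_rep_game[OF assms(1)]
      by (subst Max_le_iff) (auto simp: finite_strategies strategies_nonempty)
  qed
  ultimately show ?thesis
    by blast
qed

end
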